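(* Let $k\in[K]$ and $\boldsymbol{\delta}\in\Delta_k$. If $\boldsymbol{\delta}$ does not satisfy all four of the following properties simultaneously, then $\boldsymbol{\delta}$ is not a Pareto cut: 1. $T_k(\boldsymbol{\delta})>1$; 2. $\delta_1\le r_{i_{k,1}}$; 3. for all $\ell\in\{2,\ldots,L_k\}$, if $\delta_\ell<r_{i_{k,\ell}}$, then $\delta_\ell=\delta_{\ell+1}$; 4. $\delta_{T_k(\boldsymbol{\delta})}=\cdots=\delta_{L_k+1}$.
   Context: Notation: $[n]=\{1,\ldots,n\}$. There are products $[N+1]$, where product $N+1$ is the no-purchase option, with revenues $r_1,\ldots,r_N>0$ and $r_{N+1}=0$. There are $K$ rankings; for each $k\in[K]$, $i_{k,1},\ldots,i_{k,N+1}$ is a permutation of $[N+1]$ listing the products from most to least preferred by ranking $k$. $L_k$ is the number of products preferred to the no-purchase option by ranking $k$, so $i_{k,L_k+1}=N+1$; it is assumed that $L_k\ge1$ for all $k$. Let $\mathcal{X}^c=\{\mathbf{x}\in[0,1]^{N+1}: x_{N+1}=1\}$. Let $\mathcal{R}_k=\{r_{i_{k,\ell}}:\ell\in\{1,\ldots,L_k+1\}\}$ and $\bar r_k=\max\mathcal{R}_k$. Let $$\Delta_k=\{\boldsymbol{\delta}\in\mathbb{R}^{L_k+1}: 0\le\delta_1\le\cdots\le\delta_{L_k+1}\le\bar r_k\},$$ $$J_k(\mathbf{x},\boldsymbol{\delta})=\delta_{L_k+1}+\sum_{\ell=1}^{L_k}\left(\max\{0,r_{i_{k,\ell}}-\delta_\ell\}-(\delta_{\ell+1}-\delta_\ell)\right)x_{i_{k,\ell}}.$$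 $\boldsymbol{\delta}\in\Delta_k$ dominates $\boldsymbol{\delta}'\in\Delta_k$ if $J_k(\mathbf{x},\boldsymbol{\delta})\le J_k(\mathbf{x},\boldsymbol{\delta}')$ for all $\mathbf{x}\in\mathcal{X}^c$, with strict inequality at some $\bar{\mathbf{x}}\in\mathcal{X}^c$; $\boldsymbol{\delta}\in\Delta_k$ is a Pareto cut if no $\boldsymbol{\delta}'\in\Delta_k$ dominates it. For $\boldsymbol{\delta}\in\Delta_k$, $T_k(\boldsymbol{\delta})=\max\{L\in\{1,\ldots,L_k+1\}:\delta_L\le r_{i_{k,L}}\}$ (this set is always nonempty). *)

theory Defs
  imports Complex_Main "HOL-Library.FuncSet"
begin

text \<open>
  Products are \<open>1, \<dots>, N + 1\<close>, product \<open>N + 1\<close> being the no-purchase option, and \<open>i k \<ell>\<close> is the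
  product in position \<open>\<ell>\<close> (position 1 is best) of ranking \<open>k\<close>. A vector in \<open>\<real>\<^sup>n\<close> is an extensional
  function on \<open>{1..n}\<close>, that is, an element of \<open>{1..n} \<rightarrow>\<^sub>E UNIV\<close>.
\<close>

definition preferred :: "nat \<Rightarrow> (nat \<Rightarrow> nat \<Rightarrow> nat) \<Rightarrow> nat \<Rightarrow> nat \<Rightarrow> nat \<Rightarrow> bool" where
  "preferred N i k p q \<longleftrightarrow>
     (\<exists>a\<in>{1..N+1}. \<exists>b\<in>{1..N+1}. a < b \<and> i k a = p \<and> i k b = q)"

definition num_pref :: "nat \<Rightarrow> (nat \<Rightarrow> nat \<Rightarrow> nat) \<Rightarrow> nat \<Rightarrow> nat" where
  "num_pref N i k = card {p \<in> {1..N+1}. preferred N i k p (N+1)}"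

locale ranking_model =
  fixes N K :: nat and r :: "nat \<Rightarrow> real" and i :: "nat \<Rightarrow> nat \<Rightarrow> nat"
  assumes revenue_pos: "\<And>p. p \<in> {1..N} \<Longrightarrow> r p > 0"
    and revenue_no_purchase: "r (N+1) = 0"
    and ranking_perm: "\<And>k. k \<in> {1..K} \<Longrightarrow> bij_betw (i k) {1..N+1} {1..N+1}"
    and num_pref_ge_1: "\<And>k. k \<in> {1..K} \<Longrightarrow> num_pref N i k \<ge> 1"

definition Xc :: "nat \<Rightarrow> (nat \<Rightarrow> real) set" where
  "Xc N = {x \<in> {1..N+1} \<rightarrow>\<^sub>E {0..1}. x (N+1) = 1}"

definition max_revenue :: "nat \<Rightarrow> (nat \<Rightarrow> real) \<Rightarrow> (nat \<Rightarrow> nat \<Rightarrow> nat) \<Rightarrow> nat \<Rightarrow> real" where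
  "max_revenue N r i k = Max ((\<lambda>l. r (i k l)) ` {1..num_pref N i k + 1})"

definition Delta :: "nat \<Rightarrow> (nat \<Rightarrow> real) \<Rightarrow> (nat \<Rightarrow> nat \<Rightarrow> nat) \<Rightarrow> nat \<Rightarrow> (nat \<Rightarrow> real) set" where
  "Delta N r i k =
     {\<delta> \<in> {1..num_pref N i k + 1} \<rightarrow>\<^sub>E UNIV.
        0 \<le> \<delta> 1 \<and> (\<forall>l\<in>{1..num_pref N i k}. \<delta> l \<le> \<delta> (l+1)) \<and>
        \<delta> (num_pref N i k + 1) \<le> max_revenue N r i k}"

definition J :: "nat \<Rightarrow> (nat \<Rightarrow> real) \<Rightarrow> (nat \<Rightarrow> nat \<Rightarrow> nat) \<Rightarrow> nat \<Rightarrow>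
    (nat \<Rightarrow> real) \<Rightarrow> (nat \<Rightarrow> real) \<Rightarrow> real" where
  "J N r i k x \<delta> = \<delta> (num_pref N i k + 1) +
     (\<Sum>l=1..num_pref N i k.
        (max 0 (r (i k l) - \<delta> l) - (\<delta> (l+1) - \<delta> l)) * x (i k l))"

definition dominates :: "nat \<Rightarrow> (nat \<Rightarrow> real) \<Rightarrow> (nat \<Rightarrow> nat \<Rightarrow> nat) \<Rightarrow> nat \<Rightarrow>
    (nat \<Rightarrow> real) \<Rightarrow> (nat \<Rightarrow> real) \<Rightarrow> bool" where
  "dominates N r i k \<delta> \<delta>' \<longleftrightarrow>
     (\<forall>x\<in>Xc N. J N r i k x \<delta> \<le> J N r i k x \<delta>') \<and>
     (\<exists>x\<in>Xc N. J N r i k x \<delta> < J N r i k x \<delta>')"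

definition pareto_cut :: "nat \<Rightarrow> (nat \<Rightarrow> real) \<Rightarrow> (nat \<Rightarrow> nat \<Rightarrow> nat) \<Rightarrow> nat \<Rightarrow>
    (nat \<Rightarrow> real) \<Rightarrow> bool" where
  "pareto_cut N r i k \<delta> \<longleftrightarrow>
     \<delta> \<in> Delta N r i k \<and> \<not> (\<exists>\<delta>'\<in>Delta N r i k. dominates N r i k \<delta>' \<delta>)"

definition T :: "nat \<Rightarrow> (nat \<Rightarrow> real) \<Rightarrow> (nat \<Rightarrow> nat \<Rightarrow> nat) \<Rightarrow> nat \<Rightarrow> (nat \<Rightarrow> real) \<Rightarrow> nat" where
  "T N r i k \<delta> = Max {l \<in> {1..num_pref N i k + 1}. \<delta> l \<le> r (i k l)}"

context ranking_model
begin

lemma num_pref_position: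
  assumes k: "k \<in> {1..K}"
  shows "num_pref N i k + 1 \<in> {1..N+1}" and "i k (num_pref N i k + 1) = N + 1"
proof -
  have bij: "bij_betw (i k) {1..N+1} {1..N+1}" using ranking_perm[OF k] .
  then obtain b where b: "b \<in> {1..N+1}" "i k b = N + 1"
    by (metis atLeastAtMost_iff bij_betw_iff_bijections le_add2 order_refl)
  have inj: "inj_on (i k) {1..N+1}" using bij by (rule bij_betw_imp_inj_on)
  have eq: "{p \<in> {1..N+1}. preferred N i k p (N+1)} = i k ` {1..<b}"
  proof (intro equalityI subsetI)
    fix p assume "p \<in> {p \<in> {1..N+1}. preferred N i k p (N+1)}"
    then obtain a c where ac: "a \<in> {1..N+1}" "c \<in> {1..N+1}" "a < c" "i k a = p" "i k c = N+1"
      unfolding preferred_def by blast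
    have "c = b" using inj_onD[OF inj, of c b] ac b by simp
    then show "p \<in> i k ` {1..<b}" using ac by auto
  next
    fix p assume "p \<in> i k ` {1..<b}"
    then obtain a where a: "a \<in> {1..<b}" "p = i k a" by blast
    have a': "a \<in> {1..N+1}" using a b by auto
    have "p \<in> {1..N+1}" using bij_betwE[OF bij] a' a by blast
    moreover have "preferred N i k p (N+1)"
      unfolding preferred_def using a a' b by (intro bexI[of _ a] bexI[of _ b]) auto
    ultimately show "p \<in> {p \<in> {1..N+1}. preferred N i k p (N+1)}" by blast
  qed
  have "inj_on (i k) {1..<b}" by (rule inj_on_subset[OF inj]) (use b in auto)
  then have "num_pref N i k = b - 1"
    unfolding num_pref_def eq by (simp add: card_image)
  then show "num_pref N i k + 1 \<in> {1..N+1}" "i k (num_pref N i k + 1) = N + 1"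
    using b by auto
qed

lemma T_set_nonempty:
  assumes "\<delta> \<in> Delta N r i k"
  shows "{l \<in> {1..num_pref N i k + 1}. \<delta> l \<le> r (i k l)} \<noteq> {}"
proof -
  let ?L = "num_pref N i k"
  have "max_revenue N r i k \<in> (\<lambda>l. r (i k l)) ` {1..?L + 1}"
    unfolding max_revenue_def by (rule Max_in) auto
  then obtain m where m: "m \<in> {1..?L+1}" "r (i k m) = max_revenue N r i k" by auto
  have step: "\<And>l. l \<in> {1..?L} \<Longrightarrow> \<delta> l \<le> \<delta> (l+1)" and top: "\<delta> (?L+1) \<le> max_revenue N r i k"
    using assms unfolding Delta_def by auto
  have "m \<le> ?L + 1" using m by simp
  then have "\<delta> m \<le> \<delta> (?L + 1)"
  proof (induction rule: inc_induct)
    case (step n)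
    with m have "\<delta> n \<le> \<delta> (n+1)" using \<open>\<And>l. l \<in> {1..?L} \<Longrightarrow> \<delta> l \<le> \<delta> (l+1)\<close>[of n] by auto
    with step show ?case by simp
  qed simp
  with m top show ?thesis by auto
qed

end

end

theory Submission
  imports Defs
begin

text \<open>
  Write \<open>L\<close> for the number of products preferred to no purchase and \<open>\<rho> l = r (i k l)\<close>. Since
  \<open>max 0 (\<rho> l - \<delta> l) + \<delta> l = max (\<delta> l) (\<rho> l)\<close>, the cut is
  \<open>\<delta> (L+1) + (\<Sum>l=1..L. (max (\<delta> l) (\<rho> l) - \<delta> (l+1)) * x (i k l))\<close>, an affine function of \<open>x\<close> in
  which \<open>\<delta> l\<close> enters the coefficient of position \<open>l\<close> only through \<open>max (\<delta> l) (\<rho> l)\<close> and that of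
  position \<open>l - 1\<close> with a minus sign. Each violated property leaves room for a change of \<open>\<delta>\<close>
  that improves the cut.

  \<^item> If \<open>\<delta> 1 > \<rho> 1\<close>, lower \<open>\<delta> 1\<close> to \<open>\<rho> 1\<close>: no position precedes the first, so only one
    coefficient changes, and it decreases (\<open>first_entry_above_revenue\<close>).
  \<^item> If \<open>\<delta> l < \<rho> l\<close> and \<open>\<delta> l < \<delta> (l+1)\<close> with \<open>2 \<le> l \<le> L\<close>, raise \<open>\<delta> l\<close> to the smaller of the two
    bounds: \<open>max (\<delta> l) (\<rho> l)\<close> stays put and the coefficient of position \<open>l - 1\<close> decreases
    (\<open>entry_below_revenue_and_successor\<close>).
  \<^item> Properties 1 and 4 fail for a common reason: \<open>\<delta>\<close> ends in a run of its top value \<open>d = \<delta> (L+1)\<close>,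
    on positions \<open>m+1, \<dots>, L+1\<close>, where \<open>d\<close> exceeds all revenues \<open>\<rho> l\<close>. Lowering the top value to
    some \<open>c < d\<close> not below these revenues leaves the coefficients inside the run at \<open>0\<close>. The
    constant term falls by \<open>d - c\<close>, while only the coefficient of position \<open>m\<close> can rise, and by at
    most \<open>d - c\<close>; as \<open>x\<close> is at most \<open>1\<close> there, the cut never gets worse, and it improves strictly when
    nothing is offered (\<open>top_run_above_revenues\<close>). If property 4 fails, \<open>m\<close> is the last position with
    \<open>\<delta> m < d\<close>; if \<open>T = 1\<close> and \<open>\<delta>\<close> is constant, \<open>m = 1\<close> works.
\<close>

lemma J_coefficient_form:
  "J N r i k x \<delta> = \<delta> (num_pref N i k + 1) +
     (\<Sum>l=1..num_pref N i k. (max (\<delta> l) (r (i k l)) - \<delta> (l+1)) * x (i k l))"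
proof -
  have "max 0 (a - b) - (c - b) = max b a - c" for a b c :: real
    by (simp add: max_def)
  then show ?thesis
    unfolding J_def by (simp only:)
qed

lemma Delta_mono:
  assumes "\<delta> \<in> Delta N r i k" "1 \<le> a" "a \<le> b" "b \<le> num_pref N i k + 1"
  shows "\<delta> a \<le> \<delta> b"
  using assms(3,4,2)
proof (induction rule: dec_induct)
  case (step n)
  then have "n \<in> {1..num_pref N i k}" by auto
  with assms(1) have "\<delta> n \<le> \<delta> (n+1)" unfolding Delta_def by blast
  with step show ?case by simp
qed simp

context ranking_model
begin

lemma Xc_ranked_bounds:
  assumes "k \<in> {1..K}" "x \<in> Xc N" "l \<in> {1..num_pref N i k}"
  shows "0 \<le> x (i k l)" "x (i k l) \<le> 1"
proof -
  have "l \<in> {1..N+1}" using assms num_pref_position(1)[OF assms(1)] by auto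
  then have "i k l \<in> {1..N+1}" using bij_betwE[OF ranking_perm[OF assms(1)]] by blast
  then have "x (i k l) \<in> {0..1}" using assms(2) unfolding Xc_def by blast
  then show "0 \<le> x (i k l)" "x (i k l) \<le> 1" by auto
qed

lemma ranked_position_range:
  assumes "k \<in> {1..K}" "l \<in> {1..num_pref N i k}"
  shows "i k l \<in> {1..N}"
proof -
  let ?L = "num_pref N i k"
  have bij: "bij_betw (i k) {1..N+1} {1..N+1}" using ranking_perm[OF assms(1)] .
  have l: "l \<in> {1..N+1}" and L: "?L + 1 \<in> {1..N+1}"
    using assms num_pref_position(1)[OF assms(1)] by auto
  have "i k l \<noteq> i k (?L+1)"
    using inj_onD[OF bij_betw_imp_inj_on[OF bij] _ l L] assms(2) by auto
  then have "i k l \<noteq> N + 1" using num_pref_position(2)[OF assms(1)] by simp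
  moreover have "i k l \<in> {1..N+1}" using bij_betwE[OF bij] l by blast
  ultimately show ?thesis by auto
qed

text \<open>
  The cut is affine in \<open>x \<ge> 0\<close>, so domination may be checked coefficient by coefficient; a strict
  inequality in one coefficient shows at the assortment that offers every product.
\<close>

lemma dominates_if_coefficients_le:
  assumes k: "k \<in> {1..K}"
    and const: "\<delta>' (num_pref N i k + 1) \<le> \<delta> (num_pref N i k + 1)"
    and le: "\<And>l. l \<in> {1..num_pref N i k} \<Longrightarrow>
      max (\<delta>' l) (r (i k l)) - \<delta>' (l+1) \<le> max (\<delta> l) (r (i k l)) - \<delta> (l+1)"
    and m: "m \<in> {1..num_pref N i k}"
    and less: "max (\<delta>' m) (r (i k m)) - \<delta>' (m+1) < max (\<delta> m) (r (i k m)) - \<delta> (m+1)"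
  shows "dominates N r i k \<delta>' \<delta>"
  unfolding dominates_def
proof (intro conjI ballI)
  fix x assume x: "x \<in> Xc N"
  show "J N r i k x \<delta>' \<le> J N r i k x \<delta>"
    unfolding J_coefficient_form
    by (intro add_mono const sum_mono mult_right_mono le Xc_ranked_bounds[OF k x])
next
  let ?x = "\<lambda>p\<in>{1..N+1}. 1 :: real"
  have x: "?x \<in> Xc N" unfolding Xc_def by auto
  have one: "?x (i k l) = 1" if "l \<in> {1..num_pref N i k}" for l
    using ranked_position_range[OF k that] by auto
  have "J N r i k ?x \<delta>' < J N r i k ?x \<delta>"
    unfolding J_coefficient_form
  proof (rule add_le_less_mono[OF const], rule sum_strict_mono_ex1)
    show "\<forall>l\<in>{1..num_pref N i k}.
        (max (\<delta>' l) (r (i k l)) - \<delta>' (l+1)) * ?x (i k l)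
          \<le> (max (\<delta> l) (r (i k l)) - \<delta> (l+1)) * ?x (i k l)"
      using le one by simp
    show "\<exists>l\<in>{1..num_pref N i k}.
        (max (\<delta>' l) (r (i k l)) - \<delta>' (l+1)) * ?x (i k l)
          < (max (\<delta> l) (r (i k l)) - \<delta> (l+1)) * ?x (i k l)"
      using m less one by (intro bexI[of _ m]) simp_all
  qed simp
  then show "\<exists>x\<in>Xc N. J N r i k x \<delta>' < J N r i k x \<delta>" using x by blast
qed

lemma first_entry_above_revenue:
  assumes k: "k \<in> {1..K}" and D: "\<delta> \<in> Delta N r i k"
    and gt: "r (i k 1) < \<delta> 1"
  shows "\<not> pareto_cut N r i k \<delta>"
proof -
  let ?L = "num_pref N i k"
  let ?\<delta>' = "\<delta>(1 := r (i k 1))"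
  have L: "1 \<in> {1..?L}" using num_pref_ge_1[OF k] by simp
  have pos: "0 < r (i k 1)" using revenue_pos[OF ranked_position_range[OF k L]] .
  have "?\<delta>' \<in> Delta N r i k"
    using D gt pos L unfolding Delta_def by (fastforce simp: PiE_iff extensional_def)
  moreover have "dominates N r i k ?\<delta>' \<delta>"
    using L gt by (intro dominates_if_coefficients_le[OF k, where m = 1]) auto
  ultimately show ?thesis unfolding pareto_cut_def by blast
qed

lemma entry_below_revenue_and_successor:
  assumes k: "k \<in> {1..K}" and D: "\<delta> \<in> Delta N r i k"
    and l: "l \<in> {2..num_pref N i k}"
    and rev: "\<delta> l < r (i k l)" and succ: "\<delta> l < \<delta> (l+1)"
  shows "\<not> pareto_cut N r i k \<delta>"
proof -
  let ?L = "num_pref N i k"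
  let ?v = "min (r (i k l)) (\<delta> (l+1))"
  let ?\<delta>' = "\<delta>(l := ?v)"
  have v: "\<delta> l < ?v" using rev succ by simp
  have "?\<delta>' \<in> Delta N r i k"
    unfolding Delta_def
  proof (intro CollectI conjI ballI)
    show "?\<delta>' \<in> {1..?L + 1} \<rightarrow>\<^sub>E UNIV"
      using D l unfolding Delta_def by (auto simp: PiE_iff extensional_def)
    show "0 \<le> ?\<delta>' 1" "?\<delta>' (?L + 1) \<le> max_revenue N r i k"
      using D l unfolding Delta_def by auto
    fix j assume "j \<in> {1..?L}"
    then have "\<delta> j \<le> \<delta> (j+1)" using D unfolding Delta_def by blast
    then show "?\<delta>' j \<le> ?\<delta>' (j+1)" using v by auto
  qed
  moreover have "dominates N r i k ?\<delta>' \<delta>"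
    using l v rev by (intro dominates_if_coefficients_le[OF k, where m = "l - 1"]) auto
  ultimately show ?thesis unfolding pareto_cut_def by blast
qed

text \<open>
  The run has to be lowered as a whole, including its last entry: lowering only its first entries
  raises the coefficient of position \<open>m\<close>, and no smaller constant term makes up for it. Position \<open>1\<close> is exempt from the bound \<open>\<delta> l < d\<close> because no coefficient precedes it;
  this is how the run may cover all of \<open>\<delta>\<close> when \<open>m = 1\<close>.
\<close>

lemma top_run_above_revenues:
  assumes k: "k \<in> {1..K}" and D: "\<delta> \<in> Delta N r i k"
    and d: "d = \<delta> (num_pref N i k + 1)"
    and m: "m \<in> {1..num_pref N i k}"
    and before: "\<And>l. l \<in> {2..m} \<Longrightarrow> \<delta> l < d"
    and run: "\<And>l. l \<in> {m+1..num_pref N i k + 1} \<Longrightarrow> \<delta> l = d \<and> r (i k l) < d"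
  shows "\<not> pareto_cut N r i k \<delta>"
proof -
  let ?L = "num_pref N i k"
  define A where "A = \<delta> ` {2..m} \<union> (\<lambda>l. r (i k l)) ` {m+1..?L+1}"
  define c where "c = Max A"
  have A: "finite A" "A \<noteq> {}" using m by (auto simp: A_def)
  have c_d: "c < d"
    unfolding c_def using A before run by (subst Max_less_iff) (auto simp: A_def)
  have c_before: "\<delta> l \<le> c" if "l \<in> {2..m}" for l
    unfolding c_def by (rule Max_ge) (use A that in \<open>auto simp: A_def\<close>)
  have c_run: "r (i k l) \<le> c" if "l \<in> {m+1..?L+1}" for l
    unfolding c_def by (rule Max_ge) (use A that in \<open>auto simp: A_def\<close>)
  \<comment> \<open>The no-purchase option closes the run, and its revenue \<open>0\<close> keeps \<open>c\<close> nonnegative.\<close>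
  have c_nonneg: "0 \<le> c"
    using c_run[of "?L+1"] m num_pref_position(2)[OF k] revenue_no_purchase by simp

  define \<delta>' where "\<delta>' = (\<lambda>l\<in>{1..?L+1}. min (\<delta> l) c)"
  have \<delta>': "\<delta>' l = min (\<delta> l) c" if "l \<in> {1..?L+1}" for l
    using that by (simp add: \<delta>'_def)
  have top: "\<delta>' (?L+1) = c" using \<delta>'[of "?L+1"] c_d d by simp
  have D': "\<delta>' \<in> Delta N r i k"
    unfolding Delta_def
  proof (intro CollectI conjI ballI)
    show "\<delta>' \<in> {1..?L + 1} \<rightarrow>\<^sub>E UNIV" by (simp add: \<delta>'_def)
    show "0 \<le> \<delta>' 1" using \<delta>'[of 1] D c_nonneg by (simp add: Delta_def)
    show "\<delta>' (?L + 1) \<le> max_revenue N r i k"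
      using top c_d d D by (simp add: Delta_def)
    fix l assume l: "l \<in> {1..?L}"
    then have "\<delta> l \<le> \<delta> (l+1)" using D unfolding Delta_def by blast
    then show "\<delta>' l \<le> \<delta>' (l+1)" using l \<delta>'[of l] \<delta>'[of "l+1"] by auto
  qed

  define e where "e = (\<lambda>l. max (\<delta>' l) (r (i k l)) - \<delta>' (l+1)
    - (max (\<delta> l) (r (i k l)) - \<delta> (l+1)))"
  have e_le: "e l \<le> (if l = m then d - c else 0)" if l: "l \<in> {1..?L}" for l
  proof -
    have eqs: "\<delta>' l = min (\<delta> l) c" "\<delta>' (l+1) = min (\<delta> (l+1)) c"
      using \<delta>'[of l] \<delta>'[of "l+1"] l by auto
    consider "l < m" | "l = m" | "m < l" by linarith
    then show ?thesis
    proof cases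
      case 1
      then have "\<delta> (l+1) \<le> c" using c_before[of "l+1"] l by auto
      then show ?thesis using 1 eqs unfolding e_def by simp
    next
      case 2
      then have "\<delta> (l+1) = d" using run[of "l+1"] l by auto
      then show ?thesis using 2 eqs c_d unfolding e_def by simp
    next
      case 3
      then have "\<delta> l = d" "\<delta> (l+1) = d" "r (i k l) \<le> c"
        using run[of l] run[of "l+1"] c_run[of l] l by auto
      then show ?thesis using 3 eqs c_d unfolding e_def by simp
    qed
  qed

  have J_diff: "J N r i k x \<delta>' - J N r i k x \<delta> = (c - d) + (\<Sum>l=1..?L. e l * x (i k l))" for x
    unfolding J_coefficient_form e_def top d[symmetric]
    by (simp add: left_diff_distrib sum_subtractf)

  have "dominates N r i k \<delta>' \<delta>"
    unfolding dominates_def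
  proof (intro conjI ballI)
    fix x assume x: "x \<in> Xc N"
    have "e l * x (i k l) \<le> (if l = m then d - c else 0)" if l: "l \<in> {1..?L}" for l
    proof -
      note xl = Xc_ranked_bounds[OF k x l]
      have "e l * x (i k l) \<le> (if l = m then d - c else 0) * x (i k l)"
        by (rule mult_right_mono[OF e_le[OF l] xl(1)])
      also have "\<dots> \<le> (if l = m then d - c else 0)"
        using xl(2) c_d by (auto intro: mult_left_le)
      finally show ?thesis .
    qed
    then have "(\<Sum>l=1..?L. e l * x (i k l)) \<le> (\<Sum>l=1..?L. if l = m then d - c else 0)"
      by (rule sum_mono)
    also have "\<dots> = d - c" using m by simp
    finally show "J N r i k x \<delta>' \<le> J N r i k x \<delta>" using J_diff[of x] by linarith
  next
    \<comment> \<open>With nothing on offer only the constant term is left.\<close>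
    let ?x = "\<lambda>p\<in>{1..N+1}. if p = N + 1 then 1 else 0 :: real"
    have "?x (i k l) = 0" if "l \<in> {1..?L}" for l
      using ranked_position_range[OF k that] by auto
    then have "J N r i k ?x \<delta>' - J N r i k ?x \<delta> = c - d" unfolding J_diff by simp
    then have "J N r i k ?x \<delta>' < J N r i k ?x \<delta>" using c_d by linarith
    moreover have "?x \<in> Xc N" unfolding Xc_def by auto
    ultimately show "\<exists>x\<in>Xc N. J N r i k x \<delta>' < J N r i k x \<delta>" by blast
  qed
  with D' show ?thesis unfolding pareto_cut_def by blast
qed

text \<open>
  Beyond \<open>T\<close> every entry exceeds its revenue, so the final run of \<open>\<delta>\<close> can be lowered as soon as it
  starts after \<open>T\<close>; when \<open>T = 1\<close> it may even include position \<open>1\<close>.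
\<close>

lemma run_after_T:
  assumes k: "k \<in> {1..K}" and D: "\<delta> \<in> Delta N r i k"
    and T_le: "T N r i k \<delta> \<le> num_pref N i k"
    and T: "T N r i k \<delta> = 1 \<or> \<delta> (T N r i k \<delta>) < \<delta> (num_pref N i k + 1)"
  shows "\<not> pareto_cut N r i k \<delta>"
proof -
  let ?L = "num_pref N i k"
  let ?T = "T N r i k \<delta>"
  define d where "d = \<delta> (?L + 1)"
  define S where "S = {l \<in> {1..?L}. l = 1 \<or> \<delta> l < d}"
  define m where "m = Max S"
  have "?T \<in> {l \<in> {1..?L+1}. \<delta> l \<le> r (i k l)}"
    unfolding T_def using T_set_nonempty[OF D] by (intro Max_in) auto
  then have T_S: "?T \<in> S" using T_le T by (auto simp: S_def d_def)
  have S: "finite S" by (simp add: S_def)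
  have m: "m \<in> S" unfolding m_def using S T_S by (intro Max_in) auto
  have m_ge: "l \<le> m" if "l \<in> S" for l unfolding m_def using S that by (rule Max_ge)
  show ?thesis
  proof (rule top_run_above_revenues[OF k D d_def])
    show "m \<in> {1..?L}" using m by (simp add: S_def)
    fix l
    show "\<delta> l < d" if "l \<in> {2..m}"
      using Delta_mono[OF D, of l m] m that by (auto simp: S_def)
    show "\<delta> l = d \<and> r (i k l) < d" if l: "l \<in> {m+1..?L+1}"
    proof
      have l_S: "l \<notin> S" using m_ge l by force
      show "\<delta> l = d"
      proof (cases "l = ?L + 1")
        case False
        then have "d \<le> \<delta> l" using l_S l by (auto simp: S_def)
        moreover have "\<delta> l \<le> d" unfolding d_def using Delta_mono[OF D] l by auto
        ultimately show ?thesis by simp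
      qed (simp add: d_def)
      have "?T < l" using m_ge[OF T_S] l by simp
      have "\<not> \<delta> l \<le> r (i k l)"
      proof
        assume "\<delta> l \<le> r (i k l)"
        then have "l \<le> ?T" unfolding T_def using l by (intro Max_ge) auto
        with \<open>?T < l\<close> show False by simp
      qed
      with \<open>\<delta> l = d\<close> show "r (i k l) < d" by simp
    qed
  qed
qed

end

theorem theorem3:
  fixes N K k :: nat and r :: "nat \<Rightarrow> real" and i :: "nat \<Rightarrow> nat \<Rightarrow> nat"
    and \<delta> :: "nat \<Rightarrow> real"
  assumes "ranking_model N K r i"
    and "k \<in> {1..K}"
    and "\<delta> \<in> Delta N r i k"
    and "\<not> (T N r i k \<delta> > 1
          \<and> \<delta> 1 \<le> r (i k 1)
          \<and> (\<forall>l\<in>{2..num_pref N i k}. \<delta> l < r (i k l) \<longrightarrow> \<delta> l = \<delta> (l+1))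
          \<and> (\<forall>l\<in>{T N r i k \<delta>..num_pref N i k + 1}. \<delta> l = \<delta> (T N r i k \<delta>)))"
  shows "\<not> pareto_cut N r i k \<delta>"
proof -
  interpret ranking_model N K r i by fact
  note k = assms(2) and D = assms(3)
  let ?L = "num_pref N i k"
  let ?T = "T N r i k \<delta>"
  have T: "?T \<in> {l \<in> {1..?L+1}. \<delta> l \<le> r (i k l)}"
    unfolding T_def using T_set_nonempty[OF D] by (intro Max_in) auto
  consider (prop1) "\<not> ?T > 1" | (prop2) "r (i k 1) < \<delta> 1"
    | (prop3) l where "l \<in> {2..?L}" "\<delta> l < r (i k l)" "\<delta> l \<noteq> \<delta> (l+1)"
    | (prop4) l where "l \<in> {?T..?L+1}" "\<delta> l \<noteq> \<delta> ?T"
    using assms(4) not_le by blast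
  then show ?thesis
  proof cases
    case prop1
    then have "?T = 1" using T by simp
    then show ?thesis using run_after_T[OF k D] num_pref_ge_1[OF k] by simp
  next
    case prop2
    then show ?thesis by (rule first_entry_above_revenue[OF k D])
  next
    case prop3
    then have "\<delta> l < \<delta> (l+1)" using Delta_mono[OF D, of l "l+1"] by simp
    with prop3 show ?thesis using entry_below_revenue_and_successor[OF k D] by blast
  next
    case prop4
    then have "\<delta> ?T < \<delta> (?L+1)"
      using Delta_mono[OF D, of ?T l] Delta_mono[OF D, of l "?L+1"] T by auto
    moreover from this have "?T \<le> ?L" using T by (cases "?T = ?L + 1") auto
    ultimately show ?thesis using run_after_T[OF k D] by blast
  qed
qed

end
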